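(* Let $\{\Gamma_i\}_{i\in\mathbb{N}}$ be a sequence of finite graphs with bounded valency. Then $\{\Gamma_i\}$ is an expander sequence if and only if the degree-zero Cheeger cohomology $H_h^0(\{\Gamma_i\})$ vanishes.
   Context: Graphs. A finite graph $\Gamma$ has a finite non-empty vertex set, also denoted $\Gamma$, and a set $E$ of directed edges; each $e\in E$ goes from its starting vertex $e^-$ to its end vertex $e^+$, edges are regarded as ordered pairs $(e^-,e^+)$, and there is an edge from $x$ to $y$ if and only if there is an edge from $y$ to $x$. $|\Gamma|$ denotes the number of vertices. The valency of a vertex is the number of directed edges starting at it. A sequence of graphs $\{\Gamma_i\}$ (with edge sets $E_i$) has bounded valency if there is $k$ such that every vertex of every $\Gamma_i$ has valency at most $k$. Expanders. The Cheeger constant of $\Gamma$ is $h(\Gamma)=\frac12\inf\frac{|\partial F|}{|F|}$, where $F$ ranges over the non-empty subsets of $\Gamma$ with $|F|\le\frac12|\Gamma|$ (the infimum over the empty family being $+\infty$) and $\partial F$ is the set of directed edges with exactly one end point in $F$. $\Gamma$ is a $(k,\varepsilon)$-expander if each vertex has valency at most $k$ and $h(\Gamma)\ge\varepsilon$. A sequence $\{\Gamma_i\}$ of finite graphs is an expander sequence if $|\Gamma_i|\to\infty$ and there exist $k$ and $\varepsilon>0$ such that every $\Gamma_i$ is a $(k,\varepsilon)$-expander. Cheeger cohomology. For a sequence $\{\Gamma_i\}_{i\in\mathbb{N}}$ of finite graphs of bounded valency, let $C^0(\{\Gamma_i\})$ be the normed space of functions $f:\coprod_i\Gamma_i\to\mathbb{C}$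 with $\|f\|=\sup_i\sum_{x\in\Gamma_i}|f(x)|<\infty$ and $\sum_{x\in\Gamma_i}f(x)=0$ for every $i$. Let $C^1(\{\Gamma_i\})$ be the normed space of functions $g:\coprod_iE_i\to\mathbb{C}$ with $\|g\|=\sup_i\sum_{e\in E_i}|g(e)|<\infty$ and $\sum_{e\in E_i}g(e)=0$ for every $i$. The coboundary map $d:C^0(\{\Gamma_i\})\to C^1(\{\Gamma_i\})$, $df(e)=f(e^+)-f(e^-)$, is a bounded linear map. For a normed space $V$, the quotient completion is $V_Q=\ell^\infty(\mathbb{N},V)/c_0(\mathbb{N},V)$, the space of bounded sequences in $V$ modulo sequences converging to $0$. Let $C^p_Q(\{\Gamma_i\})$ be the quotient completion of $C^p(\{\Gamma_i\})$, $p=0,1$; applying $d$ termwise to sequences induces a map $d:C^0_Q(\{\Gamma_i\})\to C^1_Q(\{\Gamma_i\})$. The Cheeger cohomology $H_h^*(\{\Gamma_i\})$ is the cohomology of the two-term cochain complex $(C^p_Q(\{\Gamma_i\}),d)$; in particular $H_h^0(\{\Gamma_i\})=\ker\bigl(d:C^0_Q(\{\Gamma_i\})\to C^1_Q(\{\Gamma_i\})\bigr)$.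
   Formalization: The number of vertices |Γ_i| is additionally assumed to tend to infinity; without this the claim fails, since for the constant sequence of the complete graph on two vertices the degree-zero Cheeger cohomology vanishes but the sequence is not an expander sequence. *)

theory Defs
  imports
    "HOL-Analysis.Analysis"
    "HOL-Library.Function_Algebras"
    "Graph_Theory.Pair_Digraph"
begin

text \<open>
  A pseudo graph of the library is a finite symmetric digraph whose arcs are ordered pairs of
  vertices. Loops are allowed; they contribute to the valency, but neither to the boundary of a
  vertex set nor to the coboundary map.
\<close>

definition finite_graph :: "'a pair_pre_digraph \<Rightarrow> bool" where
  "finite_graph G \<longleftrightarrow> pair_pseudo_graph G \<and> pverts G \<noteq> {}"

definition valency_le :: "nat \<Rightarrow> 'a pair_pre_digraph \<Rightarrow> bool" where
  "valency_le k G \<longleftrightarrow> (\<forall>x \<in> pverts G. out_degree (with_proj G) x \<le> k)"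

definition bounded_valency :: "(nat \<Rightarrow> 'a pair_pre_digraph) \<Rightarrow> bool" where
  "bounded_valency \<Gamma> \<longleftrightarrow> (\<exists>k. \<forall>i. valency_le k (\<Gamma> i))"


section \<open>Expanders\<close>

definition edge_boundary :: "'a pair_pre_digraph \<Rightarrow> 'a set \<Rightarrow> ('a \<times> 'a) set" where
  "edge_boundary G F = {e \<in> parcs G. (fst e \<in> F) \<noteq> (snd e \<in> F)}"

text \<open>Extended real valued, since the infimum is over the empty family if \<open>G\<close> has one vertex.\<close>

definition cheeger_constant :: "'a pair_pre_digraph \<Rightarrow> ereal" where
  "cheeger_constant G = ereal (1 / 2) *
     (INF F \<in> {F. F \<subseteq> pverts G \<and> F \<noteq> {} \<and> real (card F) \<le> 1 / 2 * real (card (pverts G))}.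
        ereal (real (card (edge_boundary G F)) / real (card F)))"

definition expander :: "nat \<Rightarrow> real \<Rightarrow> 'a pair_pre_digraph \<Rightarrow> bool" where
  "expander k \<epsilon> G \<longleftrightarrow> valency_le k G \<and> cheeger_constant G \<ge> ereal \<epsilon>"

definition vertices_to_infinity :: "(nat \<Rightarrow> 'a pair_pre_digraph) \<Rightarrow> bool" where
  "vertices_to_infinity \<Gamma> \<longleftrightarrow> filterlim (\<lambda>i. card (pverts (\<Gamma> i))) at_top sequentially"

definition expander_sequence :: "(nat \<Rightarrow> 'a pair_pre_digraph) \<Rightarrow> bool" where
  "expander_sequence \<Gamma> \<longleftrightarrow>
     vertices_to_infinity \<Gamma> \<and> (\<exists>k. \<exists>\<epsilon>>0. \<forall>i. expander k \<epsilon> (\<Gamma> i))"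


section \<open>Quotient completion\<close>

text \<open>
  A normed space is given by its set of vectors \<open>V\<close>, with the operations inherited from the ambient
  type, and its norm \<open>N\<close>. Elements of the quotient completion are cosets of the null sequences in
  the bounded sequences. Scalar multiplication and the quotient norm play no role for the
  kernel of an induced map.
\<close>

definition linf_seqs :: "'v set \<Rightarrow> ('v \<Rightarrow> real) \<Rightarrow> (nat \<Rightarrow> 'v) set" where
  "linf_seqs V N = {s. range s \<subseteq> V \<and> bdd_above (range (\<lambda>n. N (s n)))}"

definition null_seqs :: "'v set \<Rightarrow> ('v \<Rightarrow> real) \<Rightarrow> (nat \<Rightarrow> 'v) set" where
  "null_seqs V N = {s. range s \<subseteq> V \<and> (\<lambda>n. N (s n)) \<longlonglongrightarrow> 0}"

definition null_rel :: "'v::ab_group_add set \<Rightarrow> ('v \<Rightarrow> real) \<Rightarrow> ((nat \<Rightarrow> 'v) \<times> (nat \<Rightarrow> 'v)) set" where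
  "null_rel V N =
     {(s, t). s \<in> linf_seqs V N \<and> t \<in> linf_seqs V N \<and> s - t \<in> null_seqs V N}"

definition quotient_completion :: "'v::ab_group_add set \<Rightarrow> ('v \<Rightarrow> real) \<Rightarrow> (nat \<Rightarrow> 'v) set set" where
  "quotient_completion V N = linf_seqs V N // null_rel V N"

definition qc_zero :: "'v::ab_group_add set \<Rightarrow> ('v \<Rightarrow> real) \<Rightarrow> (nat \<Rightarrow> 'v) set" where
  "qc_zero V N = null_rel V N `` {0}"

text \<open>
  The map induced by \<open>T\<close> into the quotient completion of \<open>W\<close>, \<open>M\<close>: the union is over the
  representatives \<open>s\<close> of the class \<open>\<xi>\<close>, all of which give the same class.
\<close>

definition qc_map :: "'w::ab_group_add set \<Rightarrow> ('w \<Rightarrow> real) \<Rightarrow> ('v \<Rightarrow> 'w) \<Rightarrow>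
    (nat \<Rightarrow> 'v) set \<Rightarrow> (nat \<Rightarrow> 'w) set" where
  "qc_map W M T \<xi> = (\<Union>s \<in> \<xi>. null_rel W M `` {\<lambda>n. T (s n)})"


section \<open>Cheeger cohomology\<close>

text \<open>
  Cochains on a family \<open>X\<close> of finite sets (the vertex sets, respectively the edge sets). A function
  on the disjoint union \<open>Sigma UNIV X\<close> is represented by its extension by zero.
\<close>

definition cochain_norm :: "(nat \<Rightarrow> 'b set) \<Rightarrow> (nat \<times> 'b \<Rightarrow> complex) \<Rightarrow> real" where
  "cochain_norm X f = (SUP i. \<Sum>x\<in>X i. cmod (f (i, x)))"

definition cochains :: "(nat \<Rightarrow> 'b set) \<Rightarrow> (nat \<times> 'b \<Rightarrow> complex) set" where
  "cochains X = {f. (\<forall>z. z \<notin> Sigma UNIV X \<longrightarrow> f z = 0)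
     \<and> bdd_above (range (\<lambda>i. \<Sum>x\<in>X i. cmod (f (i, x))))
     \<and> (\<forall>i. (\<Sum>x\<in>X i. f (i, x)) = 0)}"

abbreviation C0 :: "(nat \<Rightarrow> 'a pair_pre_digraph) \<Rightarrow> (nat \<times> 'a \<Rightarrow> complex) set" where
  "C0 \<Gamma> \<equiv> cochains (\<lambda>i. pverts (\<Gamma> i))"

abbreviation C0_norm :: "(nat \<Rightarrow> 'a pair_pre_digraph) \<Rightarrow> (nat \<times> 'a \<Rightarrow> complex) \<Rightarrow> real" where
  "C0_norm \<Gamma> \<equiv> cochain_norm (\<lambda>i. pverts (\<Gamma> i))"

abbreviation C1 :: "(nat \<Rightarrow> 'a pair_pre_digraph) \<Rightarrow> (nat \<times> 'a \<times> 'a \<Rightarrow> complex) set" where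
  "C1 \<Gamma> \<equiv> cochains (\<lambda>i. parcs (\<Gamma> i))"

abbreviation C1_norm :: "(nat \<Rightarrow> 'a pair_pre_digraph) \<Rightarrow> (nat \<times> 'a \<times> 'a \<Rightarrow> complex) \<Rightarrow> real" where
  "C1_norm \<Gamma> \<equiv> cochain_norm (\<lambda>i. parcs (\<Gamma> i))"

definition coboundary :: "(nat \<Rightarrow> 'a pair_pre_digraph) \<Rightarrow>
    (nat \<times> 'a \<Rightarrow> complex) \<Rightarrow> (nat \<times> 'a \<times> 'a \<Rightarrow> complex)" where
  "coboundary \<Gamma> f =
     (\<lambda>(i, e). if e \<in> parcs (\<Gamma> i) then f (i, snd e) - f (i, fst e) else 0)"

definition C0_Q :: "(nat \<Rightarrow> 'a pair_pre_digraph) \<Rightarrow> (nat \<Rightarrow> nat \<times> 'a \<Rightarrow> complex) set set" where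
  "C0_Q \<Gamma> = quotient_completion (C0 \<Gamma>) (C0_norm \<Gamma>)"

definition coboundary_Q :: "(nat \<Rightarrow> 'a pair_pre_digraph) \<Rightarrow>
    (nat \<Rightarrow> nat \<times> 'a \<Rightarrow> complex) set \<Rightarrow> (nat \<Rightarrow> nat \<times> 'a \<times> 'a \<Rightarrow> complex) set" where
  "coboundary_Q \<Gamma> = qc_map (C1 \<Gamma>) (C1_norm \<Gamma>) (coboundary \<Gamma>)"

definition cheeger_H0 :: "(nat \<Rightarrow> 'a pair_pre_digraph) \<Rightarrow> (nat \<Rightarrow> nat \<times> 'a \<Rightarrow> complex) set set" where
  "cheeger_H0 \<Gamma> = {\<xi> \<in> C0_Q \<Gamma>. coboundary_Q \<Gamma> \<xi> = qc_zero (C1 \<Gamma>) (C1_norm \<Gamma>)}"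

definition cheeger_H0_vanishes :: "(nat \<Rightarrow> 'a pair_pre_digraph) \<Rightarrow> bool" where
  "cheeger_H0_vanishes \<Gamma> \<longleftrightarrow> cheeger_H0 \<Gamma> = {qc_zero (C0 \<Gamma>) (C0_norm \<Gamma>)}"


section \<open>Well-definedness\<close>

lemma cochain_norm_upper:
  assumes "f \<in> cochains X"
  shows "(\<Sum>x\<in>X i. cmod (f (i, x))) \<le> cochain_norm X f"
  using assms unfolding cochain_norm_def cochains_def by (auto intro: cSUP_upper)

lemma cochain_norm_le:
  assumes "\<And>i. (\<Sum>x\<in>X i. cmod (f (i, x))) \<le> B"
  shows "cochain_norm X f \<le> B"
  unfolding cochain_norm_def by (rule cSUP_least) (use assms in auto)

lemma cochain_norm_nonneg:
  assumes "f \<in> cochains X"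
  shows "0 \<le> cochain_norm X f"
  by (rule order_trans[OF _ cochain_norm_upper[OF assms, of 0]]) (simp add: sum_nonneg)

lemma zero_cochain: "0 \<in> cochains X"
  by (auto simp: cochains_def)

lemma cochain_norm_zero: "cochain_norm X 0 = 0"
  by (simp add: cochain_norm_def)

lemma cochain_sum_diff_le:
  assumes "f \<in> cochains X" "g \<in> cochains X"
  shows "(\<Sum>x\<in>X i. cmod ((f - g) (i, x))) \<le> cochain_norm X f + cochain_norm X g"
proof -
  have "(\<Sum>x\<in>X i. cmod ((f - g) (i, x))) \<le> (\<Sum>x\<in>X i. cmod (f (i, x)) + cmod (g (i, x)))"
    by (rule sum_mono) (simp add: norm_triangle_ineq4)
  also have "\<dots> \<le> cochain_norm X f + cochain_norm X g"
    unfolding sum.distrib by (intro add_mono cochain_norm_upper assms)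
  finally show ?thesis .
qed

lemma cochain_diff:
  assumes "f \<in> cochains X" "g \<in> cochains X"
  shows "f - g \<in> cochains X" "cochain_norm X (f - g) \<le> cochain_norm X f + cochain_norm X g"
proof -
  show "f - g \<in> cochains X"
    unfolding cochains_def
  proof (intro CollectI conjI)
    show "bdd_above (range (\<lambda>i. \<Sum>x\<in>X i. cmod ((f - g) (i, x))))"
      by (rule bdd_aboveI2, rule cochain_sum_diff_le[OF assms])
  qed (use assms in \<open>auto simp: cochains_def sum_subtractf\<close>)
  show "cochain_norm X (f - g) \<le> cochain_norm X f + cochain_norm X g"
    by (intro cochain_norm_le cochain_sum_diff_le assms)
qed

lemma equiv_null_rel: "equiv (linf_seqs (cochains X) (cochain_norm X)) (null_rel (cochains X) (cochain_norm X))"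
  (is "equiv ?L ?R")
proof (rule equivI)
  have neg: "cochain_norm X (f - g) = cochain_norm X (g - f)" for f g
    by (simp add: cochain_norm_def norm_minus_commute)
  show "?R \<subseteq> ?L \<times> ?L"
    by (auto simp: null_rel_def)
  show "refl_on ?L ?R"
    by (auto simp: refl_on_def null_rel_def null_seqs_def zero_cochain cochain_norm_zero)
  show "sym ?R"
    unfolding sym_def
  proof (intro allI impI)
    fix s t assume "(s, t) \<in> ?R"
    then show "(t, s) \<in> ?R"
      by (auto simp: null_rel_def null_seqs_def linf_seqs_def neg[of "t _"] intro!: cochain_diff)
  qed
  show "trans ?R"
  proof (rule transI)
    fix s t u assume st: "(s, t) \<in> ?R" and tu: "(t, u) \<in> ?R"
    have mem: "s n \<in> cochains X" "t n \<in> cochains X" "u n \<in> cochains X" for n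
      using st tu by (auto simp: null_rel_def linf_seqs_def)
    have le: "cochain_norm X (s n - u n) \<le> cochain_norm X (s n - t n) + cochain_norm X (t n - u n)" for n
      using cochain_diff(2)[of "s n - t n" X "u n - t n"] mem
      by (simp add: cochain_diff neg[of "t n" "u n"])
    have "(\<lambda>n. cochain_norm X (s n - t n) + cochain_norm X (t n - u n)) \<longlonglongrightarrow> 0"
      using tendsto_add[of "\<lambda>n. cochain_norm X (s n - t n)" 0 _ "\<lambda>n. cochain_norm X (t n - u n)" 0] st tu
      by (auto simp: null_rel_def null_seqs_def)
    then have "(\<lambda>n. cochain_norm X (s n - u n)) \<longlonglongrightarrow> 0"
      by (rule Lim_null_comparison[rotated])
         (auto simp: le mem cochain_diff cochain_norm_nonneg)
    then show "(s, u) \<in> ?R"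
      using st tu mem by (auto simp: null_rel_def null_seqs_def cochain_diff)
  qed
qed

lemma coboundary_sum_le:
  assumes G: "finite_graph (\<Gamma> i)" and k: "valency_le k (\<Gamma> i)"
  shows "(\<Sum>e\<in>parcs (\<Gamma> i). cmod (coboundary \<Gamma> f (i, e)))
           \<le> 2 * real k * (\<Sum>x\<in>pverts (\<Gamma> i). cmod (f (i, x)))"
proof -
  interpret pair_pseudo_graph "\<Gamma> i"
    using G by (simp add: finite_graph_def)
  let ?E = "parcs (\<Gamma> i)" and ?V = "pverts (\<Gamma> i)"
  have swap: "(\<Sum>e\<in>?E. cmod (f (i, snd e))) = (\<Sum>e\<in>?E. cmod (f (i, fst e)))"
    by (rule sum.reindex_bij_witness[of _ prod.swap prod.swap])
       (use pair_sym_arcs in \<open>auto simp: symmetric_def sym_def\<close>)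
  have "(\<Sum>e\<in>?E. cmod (f (i, fst e))) = (\<Sum>x\<in>?V. \<Sum>e\<in>{e \<in> ?E. fst e = x}. cmod (f (i, fst e)))"
    by (rule sum.group[symmetric]) (auto simp: pair_finite_arcs pair_finite_verts dest: arc_fst_in_verts in_arcsD1)
  also have "\<dots> = (\<Sum>x\<in>?V. real (out_degree (\<Gamma> i) x) * cmod (f (i, x)))"
    by (intro sum.cong) (auto simp: out_degree_def out_arcs_def)
  also have "\<dots> \<le> (\<Sum>x\<in>?V. real k * cmod (f (i, x)))"
    using k by (intro sum_mono mult_right_mono) (auto simp: valency_le_def)
  finally have fst_le: "(\<Sum>e\<in>?E. cmod (f (i, fst e))) \<le> real k * (\<Sum>x\<in>?V. cmod (f (i, x)))"
    by (simp add: sum_distrib_left)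
  have "(\<Sum>e\<in>?E. cmod (coboundary \<Gamma> f (i, e)))
      \<le> (\<Sum>e\<in>?E. cmod (f (i, snd e)) + cmod (f (i, fst e)))"
    by (intro sum_mono) (auto simp: coboundary_def norm_triangle_ineq4)
  also have "\<dots> \<le> 2 * real k * (\<Sum>x\<in>?V. cmod (f (i, x)))"
    using swap fst_le by (simp add: sum.distrib)
  finally show ?thesis .
qed

lemma coboundary_bounded:
  assumes G: "\<And>i. finite_graph (\<Gamma> i)" and k: "\<And>i. valency_le k (\<Gamma> i)" and f: "f \<in> C0 \<Gamma>"
  shows "coboundary \<Gamma> f \<in> C1 \<Gamma>" "C1_norm \<Gamma> (coboundary \<Gamma> f) \<le> 2 * real k * C0_norm \<Gamma> f"
proof -
  have le: "(\<Sum>e\<in>parcs (\<Gamma> i). cmod (coboundary \<Gamma> f (i, e))) \<le> 2 * real k * C0_norm \<Gamma> f" for i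
    using coboundary_sum_le[of \<Gamma> i k f, OF G k] cochain_norm_upper[OF f, of i]
    by (meson mult_left_mono of_nat_0_le_iff order_trans zero_le_mult_iff zero_le_numeral)
  show "coboundary \<Gamma> f \<in> C1 \<Gamma>"
    unfolding cochains_def
  proof (intro CollectI conjI allI)
    show "bdd_above (range (\<lambda>i. \<Sum>e\<in>parcs (\<Gamma> i). cmod (coboundary \<Gamma> f (i, e))))"
      by (rule bdd_aboveI2, rule le)
    fix i
    interpret pair_pseudo_graph "\<Gamma> i"
      using G[of i] by (simp add: finite_graph_def)
    have "(\<Sum>e\<in>parcs (\<Gamma> i). f (i, snd e)) = (\<Sum>e\<in>parcs (\<Gamma> i). f (i, fst e))"
      by (rule sum.reindex_bij_witness[of _ prod.swap prod.swap])
         (use pair_sym_arcs in \<open>auto simp: symmetric_def sym_def\<close>)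
    then show "(\<Sum>e\<in>parcs (\<Gamma> i). coboundary \<Gamma> f (i, e)) = 0"
      by (simp add: coboundary_def sum_subtractf)
  qed (auto simp: coboundary_def split: if_splits)
  show "C1_norm \<Gamma> (coboundary \<Gamma> f) \<le> 2 * real k * C0_norm \<Gamma> f"
    by (intro cochain_norm_le le)
qed

lemma coboundary_diff: "coboundary \<Gamma> (f - g) = coboundary \<Gamma> f - coboundary \<Gamma> g"
  by (auto simp: coboundary_def fun_eq_iff)

lemma coboundary_linf:
  assumes G: "\<And>i. finite_graph (\<Gamma> i)" and k: "\<And>i. valency_le k (\<Gamma> i)"
    and s: "s \<in> linf_seqs (C0 \<Gamma>) (C0_norm \<Gamma>)"
  shows "(\<lambda>n. coboundary \<Gamma> (s n)) \<in> linf_seqs (C1 \<Gamma>) (C1_norm \<Gamma>)"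
proof -
  have mem: "s n \<in> C0 \<Gamma>" for n
    using s by (auto simp: linf_seqs_def)
  obtain B where B: "C0_norm \<Gamma> (s n) \<le> B" for n
    using s by (auto simp: linf_seqs_def bdd_above_def)
  have "C1_norm \<Gamma> (coboundary \<Gamma> (s n)) \<le> 2 * real k * B" for n
    using coboundary_bounded(2)[OF G k mem, of n] B[of n]
    by (meson mult_left_mono of_nat_0_le_iff order_trans zero_le_mult_iff zero_le_numeral)
  then have "bdd_above (range (\<lambda>n. C1_norm \<Gamma> (coboundary \<Gamma> (s n))))"
    by (rule bdd_aboveI2)
  then show ?thesis
    using coboundary_bounded(1)[OF G k mem] by (auto simp: linf_seqs_def)
qed

lemma coboundary_Q_class:
  assumes G: "\<And>i. finite_graph (\<Gamma> i)" and bv: "bounded_valency \<Gamma>"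
    and s: "s \<in> linf_seqs (C0 \<Gamma>) (C0_norm \<Gamma>)"
  shows "coboundary_Q \<Gamma> (null_rel (C0 \<Gamma>) (C0_norm \<Gamma>) `` {s})
       = null_rel (C1 \<Gamma>) (C1_norm \<Gamma>) `` {\<lambda>n. coboundary \<Gamma> (s n)}"
proof -
  obtain k where k: "\<And>i. valency_le k (\<Gamma> i)"
    using bv by (auto simp: bounded_valency_def)
  have "congruent (null_rel (C0 \<Gamma>) (C0_norm \<Gamma>))
          (\<lambda>s. null_rel (C1 \<Gamma>) (C1_norm \<Gamma>) `` {\<lambda>n. coboundary \<Gamma> (s n)})"
  proof (rule congruentI)
    fix s t assume st: "(s, t) \<in> null_rel (C0 \<Gamma>) (C0_norm \<Gamma>)"
    then have mem: "s n - t n \<in> C0 \<Gamma>" for n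
      by (auto simp: null_rel_def null_seqs_def)
    have "(\<lambda>n. 2 * real k * C0_norm \<Gamma> (s n - t n)) \<longlonglongrightarrow> 0"
      using st by (intro tendsto_mult_right_zero) (auto simp: null_rel_def null_seqs_def)
    then have "(\<lambda>n. C1_norm \<Gamma> (coboundary \<Gamma> (s n - t n))) \<longlonglongrightarrow> 0"
      by (rule Lim_null_comparison[rotated])
         (auto simp: coboundary_bounded[OF G k mem] cochain_norm_nonneg)
    then have "((\<lambda>n. coboundary \<Gamma> (s n)), (\<lambda>n. coboundary \<Gamma> (t n))) \<in> null_rel (C1 \<Gamma>) (C1_norm \<Gamma>)"
      using st coboundary_linf[OF G k] coboundary_bounded(1)[OF G k mem]
      by (auto simp: null_rel_def null_seqs_def coboundary_diff)
    then show "null_rel (C1 \<Gamma>) (C1_norm \<Gamma>) `` {\<lambda>n. coboundary \<Gamma> (s n)}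
             = null_rel (C1 \<Gamma>) (C1_norm \<Gamma>) `` {\<lambda>n. coboundary \<Gamma> (t n)}"
      by (rule equiv_class_eq[OF equiv_null_rel])
  qed
  from UN_equiv_class[OF equiv_null_rel this s] show ?thesis
    unfolding coboundary_Q_def qc_map_def .
qed


section \<open>Degree-zero cohomology does not detect the number of vertices\<close>

text \<open>
  For the constant sequence of the complete graph on two vertices the cohomology vanishes although
  the sequence is not an expander sequence. A characterization of expander sequences by vanishing
  thus has to assume that the number of vertices tends to infinity.
\<close>

definition K2 :: "bool pair_pre_digraph" where
  "K2 = \<lparr> pverts = UNIV, parcs = {(False, True), (True, False)} \<rparr>"

lemma K2_finite_graph: "finite_graph K2"
  unfolding finite_graph_def
proof
  show "pair_pseudo_graph K2"
    by unfold_locales (auto simp: K2_def symmetric_def sym_def)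
qed (simp add: K2_def)

lemma K2_bounded_valency: "bounded_valency (\<lambda>_. K2)"
proof -
  have "out_arcs (with_proj K2) x \<subseteq> {(False, True), (True, False)}" for x
    by (auto simp: out_arcs_def K2_def)
  then have "out_degree (with_proj K2) x \<le> card {(False, True), (True, False)}" for x
    unfolding out_degree_def by (intro card_mono) auto
  then show ?thesis
    unfolding bounded_valency_def valency_le_def by blast
qed

lemma K2_not_expander_sequence: "\<not> expander_sequence (\<lambda>_. K2)"
proof
  assume "expander_sequence (\<lambda>_. K2)"
  then have "\<forall>\<^sub>F i in sequentially. Suc (card (pverts K2)) \<le> card (pverts K2)"
    unfolding expander_sequence_def vertices_to_infinity_def filterlim_at_top by blast
  then show False
    by simp
qed

lemma K2_norm:
  assumes "f \<in> C0 (\<lambda>_. K2)"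
  shows "C0_norm (\<lambda>_. K2) f \<le> C1_norm (\<lambda>_. K2) (coboundary (\<lambda>_. K2) f)"
proof (rule cochain_norm_le)
  fix i
  have neg: "f (i, True) = - f (i, False)"
    using assms by (auto simp: cochains_def K2_def UNIV_bool eq_neg_iff_add_eq_0 add.commute)
  have two: "cmod (f (i, True) - f (i, False)) = cmod (f (i, True)) + cmod (f (i, False))"
  proof -
    have "f (i, True) - f (i, False) = 2 * f (i, True)"
      by (simp add: neg)
    then show ?thesis
      by (simp only: norm_mult neg) simp
  qed
  have "(\<Sum>x\<in>pverts K2. cmod (f (i, x)))
      \<le> (\<Sum>e\<in>parcs K2. cmod (coboundary (\<lambda>_. K2) f (i, e)))"
    using norm_minus_commute[of "f (i, True)" "f (i, False)"] two
      norm_ge_zero[of "f (i, True) - f (i, False)"]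
    by (simp add: K2_def UNIV_bool coboundary_def del: norm_ge_zero)
  also have "\<dots> \<le> C1_norm (\<lambda>_. K2) (coboundary (\<lambda>_. K2) f)"
  proof -
    obtain k where "\<And>i::nat. valency_le k K2"
      using K2_bounded_valency by (auto simp: bounded_valency_def)
    from coboundary_bounded(1)[of "\<lambda>_. K2", OF K2_finite_graph this assms]
    show ?thesis by (rule cochain_norm_upper)
  qed
  finally show "(\<Sum>x\<in>pverts K2. cmod (f (i, x))) \<le> C1_norm (\<lambda>_. K2) (coboundary (\<lambda>_. K2) f)" .
qed

lemma K2_cheeger_H0_vanishes: "cheeger_H0_vanishes (\<lambda>_. K2)"
proof -
  let ?G = "\<lambda>_::nat. K2"
  let ?R0 = "null_rel (C0 ?G) (C0_norm ?G)" and ?R1 = "null_rel (C1 ?G) (C1_norm ?G)"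
  note Q = coboundary_Q_class[of ?G, OF K2_finite_graph K2_bounded_valency]
  have zero: "0 \<in> linf_seqs (C0 ?G) (C0_norm ?G)"
    by (auto simp: linf_seqs_def zero_cochain)
  have d0: "coboundary ?G 0 = 0"
    by (auto simp: coboundary_def fun_eq_iff)
  have "\<xi> = ?R0 `` {0}" if \<xi>: "\<xi> \<in> C0_Q ?G" "coboundary_Q ?G \<xi> = ?R1 `` {0}" for \<xi>
  proof -
    obtain s where s: "s \<in> linf_seqs (C0 ?G) (C0_norm ?G)" "\<xi> = ?R0 `` {s}"
      using \<xi>(1) by (auto simp: C0_Q_def quotient_completion_def elim: quotientE)
    have mem: "s n \<in> C0 ?G" for n
      using s(1) by (auto simp: linf_seqs_def)
    have "?R1 `` {\<lambda>n. coboundary ?G (s n)} = ?R1 `` {0}"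
      using \<xi>(2) Q[OF s(1)] s(2) by simp
    moreover have "0 \<in> linf_seqs (C1 ?G) (C1_norm ?G)"
      by (auto simp: linf_seqs_def zero_cochain)
    ultimately have "((\<lambda>n. coboundary ?G (s n)), 0) \<in> ?R1"
      by (rule eq_equiv_class[OF _ equiv_null_rel])
    then have "(\<lambda>n. C1_norm ?G (coboundary ?G (s n))) \<longlonglongrightarrow> 0"
      by (auto simp: null_rel_def null_seqs_def)
    then have "(\<lambda>n. C0_norm ?G (s n)) \<longlonglongrightarrow> 0"
      by (rule Lim_null_comparison[rotated]) (auto simp: mem K2_norm cochain_norm_nonneg)
    then have "(s, 0) \<in> ?R0"
      using s(1) zero mem by (auto simp: null_rel_def null_seqs_def)
    then show ?thesis
      unfolding s(2) by (rule equiv_class_eq[OF equiv_null_rel])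
  qed
  moreover have "?R0 `` {0} \<in> C0_Q ?G"
    unfolding C0_Q_def quotient_completion_def by (rule quotientI[OF zero])
  moreover have "coboundary_Q ?G (?R0 `` {0}) = ?R1 `` {0}"
  proof -
    have "(\<lambda>n. coboundary ?G ((0 :: nat \<Rightarrow> nat \<times> bool \<Rightarrow> complex) n)) = 0"
      by (rule ext) (simp only: zero_fun_apply d0)
    then show ?thesis
      using Q[OF zero] by (simp only:)
  qed
  ultimately show ?thesis
    unfolding cheeger_H0_vanishes_def cheeger_H0_def qc_zero_def by blast
qed

end

theory Submission
  imports Defs
begin

text \<open>
  Degree-zero Cheeger cohomology vanishes exactly when the coboundary map is bounded below: a failure
  of boundedness below gives, after normalization, a bounded sequence of cochains which is not null
  but whose coboundaries are. Testing on cochains supported on a single graph, boundedness below is an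
  \<open>L\<^sup>1\<close> Poincare inequality that is uniform in the graphs. It is equivalent to a uniform
  isoperimetric inequality. In one direction, apply it to the indicator function of \<open>F\<close> minus its mean.
  In the other, split a real function at its median \<open>m\<close> into \<open>(f - m)\<^sup>+\<close> and \<open>(f - m)\<^sup>-\<close>, which are
  supported on at most half of the vertices, and decompose each of these into indicator functions of
  its superlevel sets (the coarea formula).
\<close>

section \<open>Isoperimetric and Poincare inequalities\<close>

text \<open>Induction on \<open>F\<close>, removing the lowest layer of \<open>g\<close>:
  subtracting its minimum on \<open>F\<close> from \<open>g\<close> there produces a zero, so the
  support shrinks properly. The isoperimetric hypothesis ranges over all non-empty subsets of
  \<open>F\<close> because the induction passes to smaller supports.\<close>

lemma coarea_inequality:
  fixes g :: "'a \<Rightarrow> real" and c :: real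
  assumes "finite F" "finite E"
    and "\<And>S. S \<subseteq> F \<Longrightarrow> S \<noteq> {} \<Longrightarrow> c * card S \<le> card {e \<in> E. (fst e \<in> S) \<noteq> (snd e \<in> S)}"
    and "\<And>x. 0 \<le> g x" "\<And>x. x \<notin> F \<Longrightarrow> g x = 0"
  shows "c * (\<Sum>x\<in>F. g x) \<le> (\<Sum>e\<in>E. \<bar>g (snd e) - g (fst e)\<bar>)"
  using assms(1,3-5)
proof (induction F arbitrary: g rule: finite_psubset_induct)
  case (psubset F)
  show ?case
  proof (cases "F = {}")
    case True
    then show ?thesis by (simp add: sum_nonneg)
  next
    case False
    define a where "a = Min (g ` F)"
    have "a \<in> g ` F"
      unfolding a_def using psubset(1) False by (intro Min_in) auto
    then obtain y where y: "y \<in> F" "g y = a" by auto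
    have a_le: "a \<le> g x" if "x \<in> F" for x
      unfolding a_def using psubset(1) that by auto
    have a0: "0 \<le> a" using y psubset.prems(2) by metis
    \<comment> \<open>This is \<open>g\<close> minus \<open>a\<close> times the indicator function
      of \<open>F\<close>. It is still nonnegative, and it vanishes at the minimizer
      \<open>y\<close>.\<close>
    define h where "h x = (if x \<in> F then g x - a else 0)" for x
    let ?B = "{e \<in> E. (fst e \<in> F) \<noteq> (snd e \<in> F)}"
    have "c * (\<Sum>x\<in>F - {y}. h x) \<le> (\<Sum>e\<in>E. \<bar>h (snd e) - h (fst e)\<bar>)"
    proof (rule psubset.IH)
      show "F - {y} \<subset> F" using y by auto
    next
      fix S assume "S \<subseteq> F - {y}" "S \<noteq> {}"
      then show "c * card S \<le> card {e \<in> E. (fst e \<in> S) \<noteq> (snd e \<in> S)}"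
        using psubset.prems(1)[of S] by auto
    qed (use y a_le in \<open>auto simp: h_def\<close>)
    moreover have "(\<Sum>x\<in>F. h x) = (\<Sum>x\<in>F - {y}. h x)"
      using psubset(1) y by (simp add: sum.remove[of F y] h_def)
    moreover have "c * (a * card F) \<le> a * card ?B"
      using mult_left_mono[OF psubset.prems(1)[of F] a0] False by (simp add: mult_ac)
    moreover have "(\<Sum>x\<in>F. g x) = (\<Sum>x\<in>F. h x) + a * card F"
      by (simp add: h_def sum_subtractf mult.commute)
    \<comment> \<open>No cancellation occurs: with both ends in \<open>F\<close> the two shifts by
      \<open>a\<close> cancel, and with exactly one end in \<open>F\<close> the difference is in
      modulus the value of \<open>g\<close> there, which is \<open>h + a\<close> with both summands
      nonnegative.\<close>
    moreover have "(\<Sum>e\<in>E. \<bar>g (snd e) - g (fst e)\<bar>)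
        = (\<Sum>e\<in>E. \<bar>h (snd e) - h (fst e)\<bar>) + a * card ?B"
    proof -
      have bd: "(\<Sum>e\<in>E. if (fst e \<in> F) \<noteq> (snd e \<in> F) then a else 0) = a * card ?B"
        using assms(2) by (simp add: sum.inter_filter[symmetric] mult.commute)
      have "(\<Sum>e\<in>E. \<bar>g (snd e) - g (fst e)\<bar>)
          = (\<Sum>e\<in>E. \<bar>h (snd e) - h (fst e)\<bar> + (if (fst e \<in> F) \<noteq> (snd e \<in> F) then a else 0))"
      proof (rule sum.cong)
        fix e
        show "\<bar>g (snd e) - g (fst e)\<bar>
            = \<bar>h (snd e) - h (fst e)\<bar> + (if (fst e \<in> F) \<noteq> (snd e \<in> F) then a else 0)"
          using a_le[of "fst e"] a_le[of "snd e"] a0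
            psubset.prems(3)[of "fst e"] psubset.prems(3)[of "snd e"]
          by (auto simp: h_def)
      qed simp
      then show ?thesis by (simp only: sum.distrib bd)
    qed
    ultimately show ?thesis by (simp add: distrib_left)
  qed
qed

text \<open>Take \<open>m\<close> to be the smallest value of \<open>f\<close> that is exceeded on
  at most half of \<open>V\<close>; a maximal value shows that such values exist. If more than half
  of \<open>V\<close> lay below \<open>m\<close>, the largest value below \<open>m\<close> would be
  a smaller candidate.\<close>

lemma median_exists:
  fixes f :: "'a \<Rightarrow> 'b::linorder"
  assumes "finite V" "V \<noteq> {}"
  obtains m where "2 * card {x \<in> V. f x > m} \<le> card V" "2 * card {x \<in> V. f x < m} \<le> card V"
proof -
  define A where "A = {x \<in> V. 2 * card {y \<in> V. f y > f x} \<le> card V}"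
  define m where "m = Min (f ` A)"
  have finA: "finite A" using assms by (simp add: A_def)
  have "Max (f ` V) \<in> f ` V" using assms by (intro Max_in) auto
  then obtain z where z: "z \<in> V" "f z = Max (f ` V)" by force
  have top: "{y \<in> V. f y > f z} = {}"
    using assms by (auto simp: z not_less)
  have "z \<in> A"
    unfolding A_def using z(1) by (simp only: top mem_Collect_eq) simp
  then have "m \<in> f ` A"
    unfolding m_def using finA by (intro Min_in) auto
  then have up: "2 * card {x \<in> V. f x > m} \<le> card V" by (auto simp: A_def)
  have "2 * card {x \<in> V. f x < m} \<le> card V"
  proof (rule ccontr)
    let ?L = "{x \<in> V. f x < m}"
    assume *: "\<not> 2 * card ?L \<le> card V"
    then have "?L \<noteq> {}" by (metis card.empty le0 mult_0_right)
    then have "Max (f ` ?L) \<in> f ` ?L" using assms(1) by (intro Max_in) auto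
    then obtain x where x: "x \<in> ?L" "f x = Max (f ` ?L)" by force
    have "f y \<le> f x" if "y \<in> ?L" for y
      using that assms(1) unfolding x(2) by (intro Max_ge) auto
    \<comment> \<open>As \<open>x\<close> maximizes \<open>f\<close> on \<open>?L\<close>,
      everything above it lies in the complement of \<open>?L\<close>, which has fewer than half of
      the points. Hence \<open>x\<close> belongs to \<open>A\<close>, against the minimality of
      \<open>m\<close>.\<close>
    then have "{y \<in> V. f y > f x} \<subseteq> V - ?L"
      by (auto simp: not_less[symmetric])
    then have "card {y \<in> V. f y > f x} \<le> card V - card ?L"
      using assms(1) by (metis (no_types, lifting) card_Diff_subset card_mono finite_Diff
          finite_subset mem_Collect_eq subsetI)
    then have "x \<in> A" using * x(1) by (auto simp: A_def)
    then have "m \<le> f x" unfolding m_def using finA by auto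
    then show False using x(1) by auto
  qed
  with up show thesis by (rule that)
qed

text \<open>The coarea inequality needs supports of at most half the size of \<open>V\<close>, hence
  the cut at the median. It bounds the distance of \<open>f\<close> from its median; the factor 2 is
  the cost of returning to the mean, which is zero.\<close>

lemma isoperimetric_imp_poincare_real:
  fixes f :: "'a \<Rightarrow> real" and c :: real
  assumes "finite V" "V \<noteq> {}" "finite E" "E \<subseteq> V \<times> V" "0 \<le> c"
    and iso: "\<And>S. S \<subseteq> V \<Longrightarrow> S \<noteq> {} \<Longrightarrow> 2 * card S \<le> card V
      \<Longrightarrow> c * card S \<le> card {e \<in> E. (fst e \<in> S) \<noteq> (snd e \<in> S)}"
    and sum0: "(\<Sum>x\<in>V. f x) = 0"
  shows "c * (\<Sum>x\<in>V. \<bar>f x\<bar>) \<le> 2 * (\<Sum>e\<in>E. \<bar>f (snd e) - f (fst e)\<bar>)"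
proof -
  obtain m where m: "2 * card {x \<in> V. f x > m} \<le> card V" "2 * card {x \<in> V. f x < m} \<le> card V"
    using median_exists[OF assms(1,2)] .
  have half: "c * (\<Sum>x\<in>F. g x) \<le> (\<Sum>e\<in>E. \<bar>g (snd e) - g (fst e)\<bar>)"
    if "F \<subseteq> V" "2 * card F \<le> card V" "\<And>x. 0 \<le> g x" "\<And>x. x \<notin> F \<Longrightarrow> g x = 0" for F g
  proof (rule coarea_inequality)
    fix S assume S: "S \<subseteq> F" "S \<noteq> {}"
    moreover have "card S \<le> card F"
      using S(1) that(1) assms(1) by (meson card_mono finite_subset)
    ultimately show "c * card S \<le> card {e \<in> E. (fst e \<in> S) \<noteq> (snd e \<in> S)}"
      using that(1,2) by (intro iso) auto
  qed (use that assms in \<open>auto intro: finite_subset\<close>)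
  \<comment> \<open>The positive and negative parts of \<open>f - m\<close>, cut off outside
    \<open>V\<close> because \<open>half\<close> asks for vanishing on the whole complement of the
    support.\<close>
  define p where "p x = (if x \<in> V \<and> f x > m then f x - m else 0)" for x
  define q where "q x = (if x \<in> V \<and> f x < m then m - f x else 0)" for x
  have "c * (\<Sum>x\<in>V. p x) \<le> (\<Sum>e\<in>E. \<bar>p (snd e) - p (fst e)\<bar>)"
  proof -
    have "(\<Sum>x\<in>{x \<in> V. f x > m}. p x) = (\<Sum>x\<in>V. p x)"
      using assms(1) by (intro sum.mono_neutral_left) (auto simp: p_def)
    then show ?thesis
      using half[of "{x \<in> V. f x > m}" p] m by (auto simp: p_def)
  qed
  moreover have "c * (\<Sum>x\<in>V. q x) \<le> (\<Sum>e\<in>E. \<bar>q (snd e) - q (fst e)\<bar>)"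
  proof -
    have "(\<Sum>x\<in>{x \<in> V. f x < m}. q x) = (\<Sum>x\<in>V. q x)"
      using assms(1) by (intro sum.mono_neutral_left) (auto simp: q_def)
    then show ?thesis
      using half[of "{x \<in> V. f x < m}" q] m by (auto simp: q_def)
  qed
  moreover have "(\<Sum>x\<in>V. p x) + (\<Sum>x\<in>V. q x) = (\<Sum>x\<in>V. \<bar>f x - m\<bar>)"
    unfolding sum.distrib[symmetric] by (intro sum.cong) (auto simp: p_def q_def)
  \<comment> \<open>On \<open>V\<close>, \<open>p\<close> increases and \<open>q\<close> decreases
    with \<open>f\<close>, and \<open>p - q = f - m\<close>. So along an edge the variations of
    \<open>p\<close> and \<open>q\<close> add up exactly to that of \<open>f\<close>.\<close>
  moreover have "(\<Sum>e\<in>E. \<bar>p (snd e) - p (fst e)\<bar>) + (\<Sum>e\<in>E. \<bar>q (snd e) - q (fst e)\<bar>)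
      = (\<Sum>e\<in>E. \<bar>f (snd e) - f (fst e)\<bar>)"
    unfolding sum.distrib[symmetric] using assms(4) by (intro sum.cong) (auto simp: p_def q_def)
  ultimately have *: "c * (\<Sum>x\<in>V. \<bar>f x - m\<bar>) \<le> (\<Sum>e\<in>E. \<bar>f (snd e) - f (fst e)\<bar>)"
    using distrib_left[of c "\<Sum>x\<in>V. p x" "\<Sum>x\<in>V. q x"] by simp
  have "\<bar>\<Sum>x\<in>V. f x - m\<bar> \<le> (\<Sum>x\<in>V. \<bar>f x - m\<bar>)" by (rule sum_abs)
  \<comment> \<open>Since \<open>f\<close> sums to zero, the sum of \<open>f - m\<close> is
    \<open>- card V * m\<close>.\<close>
  then have mean: "card V * \<bar>m\<bar> \<le> (\<Sum>x\<in>V. \<bar>f x - m\<bar>)"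
    by (simp add: sum_subtractf sum0 abs_mult)
  have "(\<Sum>x\<in>V. \<bar>f x\<bar>) \<le> (\<Sum>x\<in>V. \<bar>f x - m\<bar> + \<bar>m\<bar>)"
    by (intro sum_mono) auto
  also have "\<dots> \<le> 2 * (\<Sum>x\<in>V. \<bar>f x - m\<bar>)"
    using mean by (simp add: sum.distrib)
  finally have "c * (\<Sum>x\<in>V. \<bar>f x\<bar>) \<le> c * (2 * (\<Sum>x\<in>V. \<bar>f x - m\<bar>))"
    using assms(5) by (rule mult_left_mono)
  with * show ?thesis by simp
qed

text \<open>Real and imaginary parts each satisfy the real inequality with factor 2, and the
  variation of each is at most that of \<open>f\<close>; adding the two gives the factor 4.\<close>

lemma isoperimetric_imp_poincare:
  fixes f :: "'a \<Rightarrow> complex" and c :: real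
  assumes "finite V" "V \<noteq> {}" "finite E" "E \<subseteq> V \<times> V" "0 \<le> c"
    and "\<And>S. S \<subseteq> V \<Longrightarrow> S \<noteq> {} \<Longrightarrow> 2 * card S \<le> card V
      \<Longrightarrow> c * card S \<le> card {e \<in> E. (fst e \<in> S) \<noteq> (snd e \<in> S)}"
    and sum0: "(\<Sum>x\<in>V. f x) = 0"
  shows "c * (\<Sum>x\<in>V. cmod (f x)) \<le> 4 * (\<Sum>e\<in>E. cmod (f (snd e) - f (fst e)))"
proof -
  note real = isoperimetric_imp_poincare_real[OF assms(1-6)]
  have "c * (\<Sum>x\<in>V. cmod (f x)) \<le> c * (\<Sum>x\<in>V. \<bar>Re (f x)\<bar> + \<bar>Im (f x)\<bar>)"
    using assms(5) by (intro mult_left_mono sum_mono cmod_le)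
  also have "\<dots> = c * (\<Sum>x\<in>V. \<bar>Re (f x)\<bar>) + c * (\<Sum>x\<in>V. \<bar>Im (f x)\<bar>)"
    by (simp add: sum.distrib distrib_left)
  also have "\<dots> \<le> 2 * (\<Sum>e\<in>E. \<bar>Re (f (snd e)) - Re (f (fst e))\<bar>)
      + 2 * (\<Sum>e\<in>E. \<bar>Im (f (snd e)) - Im (f (fst e))\<bar>)"
    using sum0 by (intro add_mono real) (simp_all flip: Re_sum Im_sum)
  also have "\<dots> \<le> 2 * (\<Sum>e\<in>E. cmod (f (snd e) - f (fst e)))
      + 2 * (\<Sum>e\<in>E. cmod (f (snd e) - f (fst e)))"
    by (intro add_mono mult_left_mono sum_mono)
      (simp_all flip: minus_complex.sel add: abs_Re_le_cmod abs_Im_le_cmod)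
  finally show ?thesis by simp
qed

text \<open>The indicator function of \<open>F\<close> minus its mean \<open>r\<close> has variation
  1 across boundary edges and 0 elsewhere. Its norm is \<open>2 * card F * (1 - r)\<close>, which is
  at least \<open>card F\<close> because \<open>r \<le> 1 / 2\<close>.\<close>

lemma poincare_imp_isoperimetric:
  fixes c :: real
  assumes "finite V" "finite E"
    and poincare: "\<And>f :: 'a \<Rightarrow> complex. (\<Sum>x\<in>V. f x) = 0
      \<Longrightarrow> c * (\<Sum>x\<in>V. cmod (f x)) \<le> (\<Sum>e\<in>E. cmod (f (snd e) - f (fst e)))"
    and "0 \<le> c" "F \<subseteq> V" "F \<noteq> {}" "2 * card F \<le> card V"
  shows "c * card F \<le> card {e \<in> E. (fst e \<in> F) \<noteq> (snd e \<in> F)}"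
proof -
  define r where "r = card F / card V"
  define f :: "'a \<Rightarrow> complex" where "f x = of_bool (x \<in> F) - of_real r" for x
  have finF: "finite F" using assms by (auto intro: finite_subset)
  have V: "card V > 0" using assms finF by (auto simp: card_gt_0_iff)
  have r: "r \<le> 1 / 2" using assms V by (simp add: r_def field_simps)
  \<comment> \<open>Kept polymorphic to serve both the complex sum of \<open>f\<close> and the real
    sum of its moduli.\<close>
  have ind: "(\<Sum>x\<in>V. of_bool (x \<in> F)) = (of_nat (card F) :: 'b::semiring_1)"
    using assms by (simp add: sum.inter_restrict[symmetric] of_bool_def Int_absorb1)
  have "(\<Sum>x\<in>V. f x) = of_nat (card F) - of_nat (card V) * of_real r"
    by (simp add: f_def sum_subtractf ind)
  also have "\<dots> = 0" using V by (simp add: r_def)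
  finally have "c * (\<Sum>x\<in>V. cmod (f x)) \<le> (\<Sum>e\<in>E. cmod (f (snd e) - f (fst e)))"
    by (rule poincare)
  also have "\<dots> = (\<Sum>e\<in>E. of_bool ((fst e \<in> F) \<noteq> (snd e \<in> F)))"
    by (intro sum.cong) (auto simp: f_def)
  also have "\<dots> = card {e \<in> E. (fst e \<in> F) \<noteq> (snd e \<in> F)}"
    using assms(2) by (simp add: of_bool_def sum.inter_filter[symmetric])
  finally have upper: "c * (\<Sum>x\<in>V. cmod (f x)) \<le> card {e \<in> E. (fst e \<in> F) \<noteq> (snd e \<in> F)}" .
  have r0: "0 \<le> r" by (simp add: r_def)
  \<comment> \<open>The modulus of \<open>f\<close> is \<open>1 - r\<close> on \<open>F\<close> and
    \<open>r\<close> off \<open>F\<close>, that is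
    \<open>of_bool (x \<in> F) * (1 - 2 * r) + r\<close>. Summing this over \<open>V\<close> gives
    the right-hand side, as \<open>card V * r = card F\<close>.\<close>
  have "card F \<le> card F * (1 - 2 * r) + card F"
    using r by (simp add: mult_left_mono)
  also have "\<dots> = (\<Sum>x\<in>V. of_bool (x \<in> F) * (1 - 2 * r) + r)"
    using V by (simp add: sum.distrib ind flip: sum_distrib_right) (simp add: r_def)
  also have "\<dots> \<le> (\<Sum>x\<in>V. cmod (f x))"
  proof (rule sum_mono)
    fix x
    have "cmod (f x) = \<bar>of_bool (x \<in> F) - r\<bar>"
      by (subst norm_of_real[where 'a = complex, symmetric]) (simp add: f_def)
    then show "of_bool (x \<in> F) * (1 - 2 * r) + r \<le> cmod (f x)"
      using r r0 by auto
  qed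
  finally have "c * card F \<le> c * (\<Sum>x\<in>V. cmod (f x))"
    using assms(4) by (rule mult_left_mono)
  with upper show ?thesis by linarith
qed

text \<open>Clears the infimum, the quotients and the factor \<open>1 / 2\<close>, which turns into
  the 2 before \<epsilon>. A graph with no admissible \<open>F\<close> fits in: the infimum is then
  infinite and the right-hand side vacuous.\<close>

lemma cheeger_constant_ge_iff:
  assumes "finite (pverts G)"
  shows "ereal \<epsilon> \<le> cheeger_constant G \<longleftrightarrow>
    (\<forall>F. F \<subseteq> pverts G \<and> F \<noteq> {} \<and> 2 * card F \<le> card (pverts G)
      \<longrightarrow> 2 * \<epsilon> * card F \<le> card (edge_boundary G F))"
proof -
  define \<F> where "\<F> = {F. F \<subseteq> pverts G \<and> F \<noteq> {} \<and> real (card F) \<le> 1 / 2 * real (card (pverts G))}"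
  define I where "I = (INF F\<in>\<F>. ereal (real (card (edge_boundary G F)) / real (card F)))"
  have "ereal \<epsilon> \<le> ereal (1 / 2) * I \<longleftrightarrow> ereal (2 * \<epsilon>) \<le> I"
    by (cases I) auto
  also have "\<dots> \<longleftrightarrow> (\<forall>F\<in>\<F>. 2 * \<epsilon> \<le> card (edge_boundary G F) / card F)"
    by (simp add: I_def le_INF_iff)
  also have "\<dots> \<longleftrightarrow> (\<forall>F\<in>\<F>. 2 * \<epsilon> * card F \<le> card (edge_boundary G F))"
  proof (rule ball_cong[OF refl])
    fix F assume "F \<in> \<F>"
    then have "card F > 0"
      using assms by (auto simp: \<F>_def card_gt_0_iff intro: finite_subset)
    then show "2 * \<epsilon> \<le> card (edge_boundary G F) / card F
        \<longleftrightarrow> 2 * \<epsilon> * card F \<le> card (edge_boundary G F)"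
      by (simp add: pos_le_divide_eq)
  qed
  also have "\<dots> \<longleftrightarrow> (\<forall>F. F \<subseteq> pverts G \<and> F \<noteq> {} \<and> 2 * card F \<le> card (pverts G)
      \<longrightarrow> 2 * \<epsilon> * card F \<le> card (edge_boundary G F))"
  proof -
    have "real n \<le> 1 / 2 * real k \<longleftrightarrow> 2 * n \<le> k" for n k by linarith
    then show ?thesis by (simp add: \<F>_def)
  qed
  finally show ?thesis by (simp add: cheeger_constant_def I_def \<F>_def)
qed


section \<open>Vanishing of cohomology as boundedness below\<close>

lemma cochain_scale:
  assumes "f \<in> cochains X"
  shows "(\<lambda>z. of_real a * f z) \<in> cochains X"
    and "cochain_norm X (\<lambda>z. of_real a * f z) \<le> \<bar>a\<bar> * cochain_norm X f"
proof -
  have le: "(\<Sum>x\<in>X i. cmod (of_real a * f (i, x))) \<le> \<bar>a\<bar> * cochain_norm X f" for i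
    using cochain_norm_upper[OF assms, of i]
    by (simp add: norm_mult mult_left_mono flip: sum_distrib_left)
  show "(\<lambda>z. of_real a * f z) \<in> cochains X"
    unfolding cochains_def
  proof (intro CollectI conjI)
    show "bdd_above (range (\<lambda>i. \<Sum>x\<in>X i. cmod (of_real a * f (i, x))))"
      by (rule bdd_aboveI2, rule le)
  qed (use assms in \<open>auto simp: cochains_def simp flip: sum_distrib_left\<close>)
  show "cochain_norm X (\<lambda>z. of_real a * f z) \<le> \<bar>a\<bar> * cochain_norm X f"
    by (intro cochain_norm_le le)
qed

lemma coboundary_scale: "coboundary \<Gamma> (\<lambda>z. a * f z) = (\<lambda>z. a * coboundary \<Gamma> f z)"
  by (auto simp: coboundary_def fun_eq_iff right_diff_distrib)

lemma null_rel_zero_iff: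
  assumes "s \<in> linf_seqs (cochains X) (cochain_norm X)"
  shows "(s, 0) \<in> null_rel (cochains X) (cochain_norm X) \<longleftrightarrow> (\<lambda>n. cochain_norm X (s n)) \<longlonglongrightarrow> 0"
proof -
  have "0 \<in> linf_seqs (cochains X) (cochain_norm X)"
    by (auto simp: linf_seqs_def zero_cochain)
  then show ?thesis
    using assms by (auto simp: null_rel_def null_seqs_def linf_seqs_def)
qed

lemma class_eq_qc_zero_iff:
  assumes "s \<in> linf_seqs (cochains X) (cochain_norm X)"
  shows "null_rel (cochains X) (cochain_norm X) `` {s} = qc_zero (cochains X) (cochain_norm X)
    \<longleftrightarrow> (\<lambda>n. cochain_norm X (s n)) \<longlonglongrightarrow> 0"
proof -
  have "0 \<in> linf_seqs (cochains X) (cochain_norm X)"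
    by (auto simp: linf_seqs_def zero_cochain)
  then show ?thesis
    unfolding qc_zero_def null_rel_zero_iff[OF assms, symmetric]
    by (intro eq_equiv_class_iff[OF equiv_null_rel] assms)
qed

text \<open>Lying in the kernel and being the zero class are both null conditions on an arbitrary
  representative. The zero class always lies in the kernel, so only the other inclusion carries
  information.\<close>

lemma cheeger_H0_vanishes_iff_null:
  assumes G: "\<And>i. finite_graph (\<Gamma> i)" and bv: "bounded_valency \<Gamma>"
  shows "cheeger_H0_vanishes \<Gamma> \<longleftrightarrow>
    (\<forall>s \<in> linf_seqs (C0 \<Gamma>) (C0_norm \<Gamma>).
      (\<lambda>n. C1_norm \<Gamma> (coboundary \<Gamma> (s n))) \<longlonglongrightarrow> 0 \<longrightarrow> (\<lambda>n. C0_norm \<Gamma> (s n)) \<longlonglongrightarrow> 0)"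
proof -
  let ?L = "linf_seqs (C0 \<Gamma>) (C0_norm \<Gamma>)"
  let ?R = "null_rel (C0 \<Gamma>) (C0_norm \<Gamma>)"
  let ?Z = "qc_zero (C0 \<Gamma>) (C0_norm \<Gamma>)"
  obtain k where k: "\<And>i. valency_le k (\<Gamma> i)"
    using bv by (auto simp: bounded_valency_def)
  have ker: "coboundary_Q \<Gamma> (?R `` {s}) = qc_zero (C1 \<Gamma>) (C1_norm \<Gamma>)
      \<longleftrightarrow> (\<lambda>n. C1_norm \<Gamma> (coboundary \<Gamma> (s n))) \<longlonglongrightarrow> 0" if "s \<in> ?L" for s
    using coboundary_Q_class[OF G bv that] class_eq_qc_zero_iff[OF coboundary_linf[OF G k that]]
    by simp
  have zero: "0 \<in> ?L" by (auto simp: linf_seqs_def zero_cochain)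
  have "coboundary \<Gamma> 0 = 0" by (auto simp: coboundary_def fun_eq_iff)
  then have "coboundary_Q \<Gamma> ?Z = qc_zero (C1 \<Gamma>) (C1_norm \<Gamma>)"
    using ker[OF zero] by (simp add: qc_zero_def cochain_norm_zero)
  moreover have "?Z \<in> C0_Q \<Gamma>"
    unfolding C0_Q_def quotient_completion_def qc_zero_def by (rule quotientI[OF zero])
  ultimately have "cheeger_H0_vanishes \<Gamma> \<longleftrightarrow>
      (\<forall>\<xi> \<in> C0_Q \<Gamma>. coboundary_Q \<Gamma> \<xi> = qc_zero (C1 \<Gamma>) (C1_norm \<Gamma>) \<longrightarrow> \<xi> = ?Z)"
    by (auto simp: cheeger_H0_vanishes_def cheeger_H0_def)
  also have "\<dots> \<longleftrightarrow> (\<forall>s \<in> ?L. coboundary_Q \<Gamma> (?R `` {s}) = qc_zero (C1 \<Gamma>) (C1_norm \<Gamma>)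
      \<longrightarrow> ?R `` {s} = ?Z)"
    by (auto simp: C0_Q_def quotient_completion_def quotient_def)
  also have "\<dots> \<longleftrightarrow> (\<forall>s \<in> ?L. (\<lambda>n. C1_norm \<Gamma> (coboundary \<Gamma> (s n))) \<longlonglongrightarrow> 0
      \<longrightarrow> (\<lambda>n. C0_norm \<Gamma> (s n)) \<longlonglongrightarrow> 0)"
    by (simp only: ker class_eq_qc_zero_iff cong: ball_cong)
  finally show ?thesis .
qed

lemma cheeger_H0_vanishes_iff_bounded_below:
  assumes G: "\<And>i. finite_graph (\<Gamma> i)" and bv: "bounded_valency \<Gamma>"
  shows "cheeger_H0_vanishes \<Gamma> \<longleftrightarrow>
    (\<exists>c>0. \<forall>f \<in> C0 \<Gamma>. c * C0_norm \<Gamma> f \<le> C1_norm \<Gamma> (coboundary \<Gamma> f))"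
proof -
  obtain k where k: "\<And>i. valency_le k (\<Gamma> i)"
    using bv by (auto simp: bounded_valency_def)
  note mem1 = coboundary_bounded(1)[OF G k]
  show ?thesis
    unfolding cheeger_H0_vanishes_iff_null[OF G bv]
  proof
    assume "\<exists>c>0. \<forall>f \<in> C0 \<Gamma>. c * C0_norm \<Gamma> f \<le> C1_norm \<Gamma> (coboundary \<Gamma> f)"
    then obtain c where c: "c > 0"
      and below: "\<And>f. f \<in> C0 \<Gamma> \<Longrightarrow> c * C0_norm \<Gamma> f \<le> C1_norm \<Gamma> (coboundary \<Gamma> f)" by auto
    show "\<forall>s \<in> linf_seqs (C0 \<Gamma>) (C0_norm \<Gamma>).
      (\<lambda>n. C1_norm \<Gamma> (coboundary \<Gamma> (s n))) \<longlonglongrightarrow> 0 \<longrightarrow> (\<lambda>n. C0_norm \<Gamma> (s n)) \<longlonglongrightarrow> 0"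
    proof (intro ballI impI)
      fix s assume s: "s \<in> linf_seqs (C0 \<Gamma>) (C0_norm \<Gamma>)"
        and lim: "(\<lambda>n. C1_norm \<Gamma> (coboundary \<Gamma> (s n))) \<longlonglongrightarrow> 0"
      have mem: "s n \<in> C0 \<Gamma>" for n using s by (auto simp: linf_seqs_def)
      have "(\<lambda>n. C1_norm \<Gamma> (coboundary \<Gamma> (s n)) / c) \<longlonglongrightarrow> 0"
        using tendsto_divide_zero[OF lim] .
      then show "(\<lambda>n. C0_norm \<Gamma> (s n)) \<longlonglongrightarrow> 0"
        by (rule Lim_null_comparison[rotated])
          (use c below mem in \<open>auto simp: cochain_norm_nonneg pos_le_divide_eq mult.commute\<close>)
    qed
  next
    assume null: "\<forall>s \<in> linf_seqs (C0 \<Gamma>) (C0_norm \<Gamma>).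
      (\<lambda>n. C1_norm \<Gamma> (coboundary \<Gamma> (s n))) \<longlonglongrightarrow> 0 \<longrightarrow> (\<lambda>n. C0_norm \<Gamma> (s n)) \<longlonglongrightarrow> 0"
    show "\<exists>c>0. \<forall>f \<in> C0 \<Gamma>. c * C0_norm \<Gamma> f \<le> C1_norm \<Gamma> (coboundary \<Gamma> f)"
    proof (rule ccontr)
      assume "\<not> ?thesis"
      \<comment> \<open>Each constant \<open>1 / (n + 1)\<close> fails as a lower bound.\<close>
      then have "\<exists>f \<in> C0 \<Gamma>. C1_norm \<Gamma> (coboundary \<Gamma> f) < inverse (real (Suc n)) * C0_norm \<Gamma> f" for n
        by (metis inverse_positive_iff_positive not_le of_nat_0_less_iff zero_less_Suc)
      then obtain f where f: "\<And>n. f n \<in> C0 \<Gamma>"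
        and small: "\<And>n. C1_norm \<Gamma> (coboundary \<Gamma> (f n)) < inverse (real (Suc n)) * C0_norm \<Gamma> (f n)"
        by metis
      \<comment> \<open>The strict inequality \<open>small\<close> has a nonnegative left-hand side,
        so the norm cannot be zero and normalization is possible.\<close>
      have pos: "C0_norm \<Gamma> (f n) > 0" for n
        using cochain_norm_nonneg[OF mem1[OF f[of n]]] small[of n]
        by (metis less_le_trans not_le mult_nonneg_nonpos inverse_nonnegative_iff_nonnegative
            of_nat_0_le_iff order.strict_trans1 order_less_irrefl)
      define s where "s n = (\<lambda>z. of_real (inverse (C0_norm \<Gamma> (f n))) * f n z)" for n
      have mem: "s n \<in> C0 \<Gamma>" for n
        unfolding s_def by (rule cochain_scale(1)[OF f])
      have "C0_norm \<Gamma> (s n) \<le> 1" for n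
        unfolding s_def using cochain_scale(2)[OF f, of "inverse (C0_norm \<Gamma> (f n))" n] pos[of n]
        by simp
      then have linf: "s \<in> linf_seqs (C0 \<Gamma>) (C0_norm \<Gamma>)"
        using mem by (auto simp: linf_seqs_def intro!: bdd_aboveI2)
      \<comment> \<open>\<open>cochain_scale\<close> bounds norms only from above; the lower bound
        comes from scaling \<open>s n\<close> back to \<open>f n\<close>.\<close>
      have ge: "1 \<le> C0_norm \<Gamma> (s n)" for n
      proof -
        have "(\<lambda>z. of_real (C0_norm \<Gamma> (f n)) * s n z) = f n"
          using pos[of n] by (simp add: s_def fun_eq_iff)
        then have "C0_norm \<Gamma> (f n) \<le> C0_norm \<Gamma> (f n) * C0_norm \<Gamma> (s n)"
          using cochain_scale(2)[OF mem, of "C0_norm \<Gamma> (f n)" n] pos[of n] by simp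
        then show ?thesis using pos[of n] by simp
      qed
      have "C1_norm \<Gamma> (coboundary \<Gamma> (s n)) \<le> inverse (real (Suc n))" for n
      proof -
        have "C1_norm \<Gamma> (coboundary \<Gamma> (s n))
            \<le> inverse (C0_norm \<Gamma> (f n)) * C1_norm \<Gamma> (coboundary \<Gamma> (f n))"
          unfolding s_def coboundary_scale
          using cochain_scale(2)[OF mem1[OF f], of "inverse (C0_norm \<Gamma> (f n))" n] pos[of n] by simp
        also have "\<dots> \<le> inverse (C0_norm \<Gamma> (f n)) * (inverse (real (Suc n)) * C0_norm \<Gamma> (f n))"
          using small[of n] pos[of n] by (intro mult_left_mono) auto
        also have "\<dots> = inverse (real (Suc n))" using pos[of n] by simp
        finally show ?thesis .
      qed
      then have "(\<lambda>n. C1_norm \<Gamma> (coboundary \<Gamma> (s n))) \<longlonglongrightarrow> 0"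
        by (intro Lim_null_comparison[OF _ LIMSEQ_inverse_real_of_nat])
          (auto simp: cochain_norm_nonneg mem1 mem)
      then have "(\<lambda>n. C0_norm \<Gamma> (s n)) \<longlonglongrightarrow> 0" using null linf by blast
      then have "1 \<le> (0::real)" by (rule LIMSEQ_le_const) (use ge in auto)
      then show False by simp
    qed
  qed
qed

section \<open>Reduction to single graphs\<close>

text \<open>Both norms are suprema over the graphs and the coboundary acts on each graph separately,
  so the same \<open>c\<close> serves on both sides. A function on one graph becomes a cochain
  through extension by zero.\<close>

lemma bounded_below_iff_poincare:
  assumes G: "\<And>i. finite_graph (\<Gamma> i)" and bv: "bounded_valency \<Gamma>" and c: "c > 0"
  shows "(\<forall>f \<in> C0 \<Gamma>. c * C0_norm \<Gamma> f \<le> C1_norm \<Gamma> (coboundary \<Gamma> f)) \<longleftrightarrow>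
    (\<forall>i. \<forall>f. (\<Sum>x\<in>pverts (\<Gamma> i). f x) = 0 \<longrightarrow>
      c * (\<Sum>x\<in>pverts (\<Gamma> i). cmod (f x)) \<le> (\<Sum>e\<in>parcs (\<Gamma> i). cmod (f (snd e) - f (fst e))))"
proof -
  obtain k where k: "\<And>i. valency_le k (\<Gamma> i)"
    using bv by (auto simp: bounded_valency_def)
  show ?thesis
  proof (intro iffI allI impI ballI)
    fix i and f :: "'a \<Rightarrow> complex"
    assume below: "\<forall>f \<in> C0 \<Gamma>. c * C0_norm \<Gamma> f \<le> C1_norm \<Gamma> (coboundary \<Gamma> f)"
      and sum0: "(\<Sum>x\<in>pverts (\<Gamma> i). f x) = 0"
    define g where "g = (\<lambda>(j, x). if j = i \<and> x \<in> pverts (\<Gamma> i) then f x else 0)"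
    have row: "(\<Sum>x\<in>pverts (\<Gamma> j). cmod (g (j, x)))
        = (if j = i then \<Sum>x\<in>pverts (\<Gamma> i). cmod (f x) else 0)" for j
      by (auto simp: g_def)
    have g: "g \<in> C0 \<Gamma>"
      unfolding cochains_def
    proof (intro CollectI conjI)
      show "bdd_above (range (\<lambda>j. \<Sum>x\<in>pverts (\<Gamma> j). cmod (g (j, x))))"
        unfolding row by (rule bdd_aboveI2[of _ _ "\<Sum>x\<in>pverts (\<Gamma> i). cmod (f x)"]) (auto simp: sum_nonneg)
    next
      show "\<forall>j. (\<Sum>x\<in>pverts (\<Gamma> j). g (j, x)) = 0"
      proof
        fix j
        show "(\<Sum>x\<in>pverts (\<Gamma> j). g (j, x)) = 0"
          using sum0 by (cases "j = i") (simp_all add: g_def)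
      qed
    qed (auto simp: g_def)
    interpret pair_pseudo_graph "\<Gamma> i"
      using G[of i] by (simp add: finite_graph_def)
    have "C1_norm \<Gamma> (coboundary \<Gamma> g) \<le> (\<Sum>e\<in>parcs (\<Gamma> i). cmod (f (snd e) - f (fst e)))"
    proof (rule cochain_norm_le)
      fix j
      show "(\<Sum>e\<in>parcs (\<Gamma> j). cmod (coboundary \<Gamma> g (j, e)))
          \<le> (\<Sum>e\<in>parcs (\<Gamma> i). cmod (f (snd e) - f (fst e)))"
      proof (cases "j = i")
        case True
        have "cmod (coboundary \<Gamma> g (i, e)) = cmod (f (snd e) - f (fst e))"
          if "e \<in> parcs (\<Gamma> i)" for e
          using that in_arcsD1[of "fst e" "snd e"] in_arcsD2[of "fst e" "snd e"]
          by (auto simp: coboundary_def g_def)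
        then show ?thesis using True by (simp cong: sum.cong)
      next
        case False
        then have "(\<Sum>e\<in>parcs (\<Gamma> j). cmod (coboundary \<Gamma> g (j, e))) = 0"
          by (intro sum.neutral) (auto simp: coboundary_def g_def)
        then show ?thesis by (simp add: sum_nonneg)
      qed
    qed
    moreover have "c * C0_norm \<Gamma> g \<le> C1_norm \<Gamma> (coboundary \<Gamma> g)" using below g by blast
    moreover have "c * (\<Sum>x\<in>pverts (\<Gamma> i). cmod (f x)) \<le> c * C0_norm \<Gamma> g"
      using cochain_norm_upper[OF g, of i] c by (simp add: row)
    ultimately show "c * (\<Sum>x\<in>pverts (\<Gamma> i). cmod (f x))
        \<le> (\<Sum>e\<in>parcs (\<Gamma> i). cmod (f (snd e) - f (fst e)))" by linarith
  next
    fix f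
    assume poincare: "\<forall>i. \<forall>f. (\<Sum>x\<in>pverts (\<Gamma> i). f x) = 0 \<longrightarrow>
      c * (\<Sum>x\<in>pverts (\<Gamma> i). cmod (f x)) \<le> (\<Sum>e\<in>parcs (\<Gamma> i). cmod (f (snd e) - f (fst e)))"
      and f: "f \<in> C0 \<Gamma>"
    \<comment> \<open>Dividing by \<open>c\<close> isolates the supremum, which is then bounded
      graph by graph.\<close>
    have "C0_norm \<Gamma> f \<le> C1_norm \<Gamma> (coboundary \<Gamma> f) / c"
    proof (rule cochain_norm_le)
      fix i
      have "c * (\<Sum>x\<in>pverts (\<Gamma> i). cmod (f (i, x)))
          \<le> (\<Sum>e\<in>parcs (\<Gamma> i). cmod (f (i, snd e) - f (i, fst e)))"
        using poincare[rule_format, of "\<lambda>x. f (i, x)" i] f by (simp add: cochains_def)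
      also have "\<dots> = (\<Sum>e\<in>parcs (\<Gamma> i). cmod (coboundary \<Gamma> f (i, e)))"
        by (simp add: coboundary_def)
      also have "\<dots> \<le> C1_norm \<Gamma> (coboundary \<Gamma> f)"
        by (rule cochain_norm_upper[OF coboundary_bounded(1)[OF G k f]])
      finally show "(\<Sum>x\<in>pverts (\<Gamma> i). cmod (f (i, x))) \<le> C1_norm \<Gamma> (coboundary \<Gamma> f) / c"
        using c by (simp add: pos_le_divide_eq mult.commute)
    qed
    then show "c * C0_norm \<Gamma> f \<le> C1_norm \<Gamma> (coboundary \<Gamma> f)"
      using c by (simp add: pos_le_divide_eq mult.commute)
  qed
qed

text \<open>Growth of the vertex sets is assumed because vanishing cannot detect it, as the constant
  sequence of \<open>K2\<close> shows. What remains is to match constants between the Cheeger and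
  Poincare inequalities.\<close>

theorem theorem2p6:
  fixes \<Gamma> :: "nat \<Rightarrow> 'a pair_pre_digraph"
  assumes "\<And>i. finite_graph (\<Gamma> i)"
    and "bounded_valency \<Gamma>"
    and "vertices_to_infinity \<Gamma>"
  shows "expander_sequence \<Gamma> \<longleftrightarrow> cheeger_H0_vanishes \<Gamma>"
proof -
  have fin: "finite (pverts (\<Gamma> i))" "finite (parcs (\<Gamma> i))" "parcs (\<Gamma> i) \<subseteq> pverts (\<Gamma> i) \<times> pverts (\<Gamma> i)"
    and ne: "pverts (\<Gamma> i) \<noteq> {}" for i
  proof -
    interpret pair_pseudo_graph "\<Gamma> i"
      using assms(1)[of i] by (simp add: finite_graph_def)
    show "finite (pverts (\<Gamma> i))" "finite (parcs (\<Gamma> i))"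
      by (rule pair_finite_verts, rule pair_finite_arcs)
    show "parcs (\<Gamma> i) \<subseteq> pverts (\<Gamma> i) \<times> pverts (\<Gamma> i)"
      by (auto dest: in_arcsD1 in_arcsD2)
    show "pverts (\<Gamma> i) \<noteq> {}"
      using assms(1)[of i] by (simp add: finite_graph_def)
  qed
  define poincare where "poincare c \<longleftrightarrow> (\<forall>i. \<forall>f :: 'a \<Rightarrow> complex. (\<Sum>x\<in>pverts (\<Gamma> i). f x) = 0 \<longrightarrow>
      c * (\<Sum>x\<in>pverts (\<Gamma> i). cmod (f x)) \<le> (\<Sum>e\<in>parcs (\<Gamma> i). cmod (f (snd e) - f (fst e))))" for c
  have H0: "cheeger_H0_vanishes \<Gamma> \<longleftrightarrow> (\<exists>c>0. poincare c)"
    unfolding cheeger_H0_vanishes_iff_bounded_below[OF assms(1,2)] poincare_def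
    using bounded_below_iff_poincare[OF assms(1,2)] by (simp cong: conj_cong)
  show ?thesis
    unfolding H0
  proof
    assume "expander_sequence \<Gamma>"
    then obtain \<epsilon> where \<epsilon>: "\<epsilon> > 0" and h: "\<And>i. ereal \<epsilon> \<le> cheeger_constant (\<Gamma> i)"
      unfolding expander_sequence_def expander_def by blast
    \<comment> \<open>A Cheeger constant of at least \<epsilon> is isoperimetry with constant
      \<open>2 * \<epsilon>\<close>, and passing to the complex Poincare inequality divides by
      4.\<close>
    have "poincare (\<epsilon> / 2)"
      unfolding poincare_def
    proof (intro allI impI)
      fix i and f :: "'a \<Rightarrow> complex"
      assume "(\<Sum>x\<in>pverts (\<Gamma> i). f x) = 0"
      then have "2 * \<epsilon> * (\<Sum>x\<in>pverts (\<Gamma> i). cmod (f x))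
          \<le> 4 * (\<Sum>e\<in>parcs (\<Gamma> i). cmod (f (snd e) - f (fst e)))"
        using h[of i] \<epsilon> unfolding cheeger_constant_ge_iff[OF fin(1)] edge_boundary_def
        by (intro isoperimetric_imp_poincare fin ne) auto
      then show "\<epsilon> / 2 * (\<Sum>x\<in>pverts (\<Gamma> i). cmod (f x))
          \<le> (\<Sum>e\<in>parcs (\<Gamma> i). cmod (f (snd e) - f (fst e)))" by simp
    qed
    then show "\<exists>c>0. poincare c" using \<epsilon> by (intro exI[of _ "\<epsilon> / 2"]) auto
  next
    assume "\<exists>c>0. poincare c"
    then obtain c where c: "c > 0" "poincare c" by blast
    obtain k where k: "\<And>i. valency_le k (\<Gamma> i)"
      using assms(2) by (auto simp: bounded_valency_def)
    \<comment> \<open>The Poincare constant \<open>c\<close> carries over unchanged to isoperimetry;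
      the halving is the factor in the definition of the Cheeger constant.\<close>
    have "ereal (c / 2) \<le> cheeger_constant (\<Gamma> i)" for i
      unfolding cheeger_constant_ge_iff[OF fin(1)]
    proof (intro allI impI)
      fix F assume "F \<subseteq> pverts (\<Gamma> i) \<and> F \<noteq> {} \<and> 2 * card F \<le> card (pverts (\<Gamma> i))"
      then have "c * card F \<le> card {e \<in> parcs (\<Gamma> i). (fst e \<in> F) \<noteq> (snd e \<in> F)}"
        using c by (intro poincare_imp_isoperimetric[of "pverts (\<Gamma> i)"] fin) (auto simp: poincare_def)
      then show "2 * (c / 2) * card F \<le> card (edge_boundary (\<Gamma> i) F)"
        by (simp add: edge_boundary_def)
    qed
    then have "expander k (c / 2) (\<Gamma> i)" for i
      using k by (simp add: expander_def)
    then show "expander_sequence \<Gamma>"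
      unfolding expander_sequence_def using assms(3) c(1) half_gt_zero by blast
  qed
qed

end
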